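(* As an identity of formal power series in $x,y,q$, \begin{align*} \frac{1}{(xq;q^2)_\infty (yq^2;q^4)_\infty} = \sum_{n_1,n_2,n_3,n_4\ge 0}\frac{x^{n_1+n_2+2n_4}y^{n_2+n_3}q^{n_1+3n_2+2n_3+2n_4}\left(1+x^2yq^{4+4(n_1+n_3)}\right)}{(q^2;q^2)_{n_1}(q^2;q^2)_{n_2}(q^4;q^4)_{n_3}(q^4;q^4)_{n_4}}\, q^{2\binom{n_1}{2}+2n_1n_2+4n_1n_3+4n_3n_4}. \end{align*}
   Context: For $n\in\mathbb{N}\cup\{\infty\}$, $(A;q)_n:=\prod_{k=0}^{n-1}(1-Aq^k)$. *)

theory Defs
  imports
    "HOL-Analysis.Analysis"
    "HOL-Computational_Algebra.Formal_Power_Series"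
begin

text \<open>
  The ring of formal power series in \<open>x\<close>, \<open>y\<close>, \<open>q\<close> over a field \<open>K\<close> is rendered as the iterated
  power series ring \<open>K[[x]][[y]][[q]]\<close>, with \<open>q\<close> outermost. The library topology on
  it is then the \<open>q\<close>-adic one (with discrete coefficients in \<open>K[[x]][[y]]\<close>). It is finer than the
  coefficientwise, i.e. \<open>(x, y, q)\<close>-adic, topology, so convergence here implies convergence there,
  to the same limit. Division is by series whose \<open>q\<close>-constant term is \<open>1\<close>, so the library division is
  multiplication by the genuine inverse although \<open>K[[x]][[y]]\<close> is not a field.
\<close>

definition vx :: "'a::comm_ring_1 fps fps fps" where
  "vx = fps_const (fps_const fps_X)"

definition vy :: "'a::comm_ring_1 fps fps fps" where
  "vy = fps_const fps_X"

definition vq :: "'a::comm_ring_1 fps fps fps" where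
  "vq = fps_X"

definition qpoch :: "'b \<Rightarrow> 'b \<Rightarrow> enat \<Rightarrow> 'b::{comm_ring_1, t2_space}" where
  "qpoch A p n =
     (case n of
        enat m \<Rightarrow> (\<Prod>k<m. 1 - A * p ^ k)
      | \<infinity> \<Rightarrow> (\<Prod>k. 1 - A * p ^ k))"

end

theory Submission
  imports Defs
begin

text \<open>
  Put \<open>p = q\<^sup>2\<close>, \<open>z = x q\<close>, \<open>Y = y q\<^sup>2\<close>. The sums over \<open>n\<^sub>4\<close> and \<open>n\<^sub>2\<close> are instances of Euler's
  \<open>\<Sum> t\<^sup>n / (p;p)\<^sub>n = 1 / (t;p)\<^sub>\<infinity>\<close>; after that the sum over \<open>n\<^sub>3\<close> is a combination of two
  q-binomial series at \<open>t\<close> and \<open>t p\<^sup>2\<close>, \<open>t = Y p\<^bsup>2 n\<^sub>1\<^esup>\<close>. The remaining sum over \<open>n\<^sub>1\<close>,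
  \<open>S(z) = \<Sum> z\<^sup>n p\<^bsup>n(n-1)/2\<^esup> (zY;p)\<^sub>n (Y;p\<^sup>2)\<^sub>n (1 - z\<^sup>2Y\<^sup>2p\<^bsup>4n\<^esup>) / ((p;p)\<^sub>n (z\<^sup>2Yp\<^sup>2;p\<^sup>2)\<^sub>n)\<close>,
  satisfies \<open>(1 - z\<^sup>2Yp\<^sup>2) S(z) = (1 + z)(1 - zY) S(zp)\<close> by telescoping, and iterating this
  evaluates it as an infinite product.
\<close>

unbundle no vec_syntax
unbundle fps_syntax

subsection \<open>Adic convergence\<close>

text \<open>Divisibility by \<open>fps_X ^ n\<close> is the working form of "equal modulo X^n".
  Limits below become divisibility statements for all \<open>n\<close>, and this equivalence
  translates them to coefficients.\<close>

lemma fps_X_power_dvd_iff: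
  fixes f :: "'b::comm_ring_1 fps"
  shows "fps_X ^ n dvd f \<longleftrightarrow> (\<forall>k<n. f $ k = 0)"
proof
  assume "fps_X ^ n dvd f"
  then show "\<forall>k<n. f $ k = 0" by (auto simp: fps_X_power_mult_nth elim!: dvdE)
next
  assume *: "\<forall>k<n. f $ k = 0"
  have "f = fps_X ^ n * fps_shift n f"
    by (rule fps_ext) (use * in \<open>auto simp: fps_X_power_mult_nth\<close>)
  then show "fps_X ^ n dvd f" by (metis dvd_triv_left)
qed

lemma fps_X_power_dvd_power:
  fixes a :: "'b::comm_ring_1 fps"
  assumes "a $ 0 = 0"
  shows "fps_X ^ n dvd a ^ n"
proof -
  have "fps_X ^ 1 dvd a" using assms by (subst fps_X_power_dvd_iff) auto
  then show ?thesis by (intro dvd_power_same) simp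
qed

lemma fps_eqI_adic:
  fixes f g :: "'b::comm_ring_1 fps"
  assumes "\<And>n. fps_X ^ n dvd f - g"
  shows "f = g"
proof (rule fps_ext)
  fix k
  show "f $ k = g $ k" using assms[of "Suc k"] unfolding fps_X_power_dvd_iff by auto
qed

text \<open>The coefficient at \<open>k\<close> stops at \<open>n = k\<close>: if
  \<open>fps_X ^ n dvd f n\<close> for all \<open>n\<close>, later terms vanish there and this is
  the X-adic sum. Being an explicit finite formula, it can be manipulated without convergence
  arguments.\<close>

definition adic_sum :: "(nat \<Rightarrow> 'b::comm_ring_1 fps) \<Rightarrow> 'b fps" where
  "adic_sum f = Abs_fps (\<lambda>k. \<Sum>n\<le>k. f n $ k)"

lemma adic_sum_nth: "adic_sum f $ k = (\<Sum>n\<le>k. f n $ k)"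
  by (simp add: adic_sum_def)

lemma adic_sum_nth':
  assumes "\<And>n. fps_X ^ n dvd f n" "k \<le> m"
  shows "adic_sum f $ k = (\<Sum>n\<le>m. f n $ k)"
  unfolding adic_sum_nth
  by (rule sum.mono_neutral_left) (use assms in \<open>auto simp: fps_X_power_dvd_iff\<close>)

lemma adic_sum_add: "adic_sum (\<lambda>n. f n + g n) = adic_sum f + adic_sum g"
  by (rule fps_ext) (simp add: adic_sum_nth sum.distrib)

lemma adic_sum_diff: "adic_sum (\<lambda>n. f n - g n) = adic_sum f - adic_sum g"
  by (rule fps_ext) (simp add: adic_sum_nth sum_subtractf)

text \<open>The coefficient at \<open>k\<close> of the product uses coefficients of
  \<open>f n\<close> at all \<open>k - i\<close>. By divisibility, the truncation at
  \<open>n = k - i\<close> may be raised to the common bound \<open>k\<close>, after which the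
  finite sums are swapped.\<close>

lemma adic_sum_cmult:
  assumes "\<And>n. fps_X ^ n dvd f n"
  shows "adic_sum (\<lambda>n. c * f n) = c * adic_sum f"
proof (rule fps_ext)
  fix k
  have "adic_sum (\<lambda>n. c * f n) $ k = (\<Sum>n\<le>k. \<Sum>i=0..k. c $ i * f n $ (k - i))"
    by (simp add: adic_sum_nth fps_mult_nth)
  also have "\<dots> = (\<Sum>i=0..k. c $ i * (\<Sum>n\<le>k. f n $ (k - i)))"
    by (subst sum.swap) (simp add: sum_distrib_left)
  also have "\<dots> = (\<Sum>i=0..k. c $ i * adic_sum f $ (k - i))"
    by (intro sum.cong refl arg_cong2[where f = "(*)"] adic_sum_nth'[symmetric] assms) auto
  finally show "adic_sum (\<lambda>n. c * f n) $ k = (c * adic_sum f) $ k"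
    by (simp add: fps_mult_nth)
qed

text \<open>The upper boundary term \<open>G (Suc k)\<close> is divisible by
  \<open>fps_X ^ Suc k\<close>, so it is invisible in the coefficient at \<open>k\<close>.\<close>

lemma adic_sum_telescope:
  assumes "\<And>n. fps_X ^ n dvd G n"
  shows "adic_sum (\<lambda>n. G (Suc n) - G n) = - G 0"
proof (rule fps_ext)
  fix k
  have "adic_sum (\<lambda>n. G (Suc n) - G n) $ k = (\<Sum>n<Suc k. G (Suc n) $ k - G n $ k)"
    by (simp add: adic_sum_nth lessThan_Suc_atMost)
  also have "\<dots> = G (Suc k) $ k - G 0 $ k"
    by (rule sum_lessThan_telescope)
  also have "G (Suc k) $ k = 0"
    using assms[of "Suc k"] unfolding fps_X_power_dvd_iff by auto
  finally show "adic_sum (\<lambda>n. G (Suc n) - G n) $ k = (- G 0) $ k" by simp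
qed

lemma adic_sum_minus_head:
  assumes "\<And>n. n > 0 \<Longrightarrow> fps_X ^ N dvd f n"
  shows "fps_X ^ N dvd adic_sum f - f 0"
  unfolding fps_X_power_dvd_iff
proof (intro allI impI)
  fix k assume "k < N"
  have "(\<Sum>n\<le>k. f n $ k) = f 0 $ k + (\<Sum>n\<in>{..k}-{0}. f n $ k)"
    by (rule sum.remove) auto
  also have "(\<Sum>n\<in>{..k}-{0}. f n $ k) = 0"
    by (rule sum.neutral) (use assms \<open>k < N\<close> in \<open>auto simp: fps_X_power_dvd_iff\<close>)
  finally show "(adic_sum f - f 0) $ k = 0" by (simp add: adic_sum_nth)
qed

text \<open>Convergence of power series means that each coefficient is eventually constant. It thus
  suffices to give, for each \<open>k\<close>, a finite set \<open>B k\<close> of indices beyond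
  which the coefficient no longer changes.\<close>

lemma has_sum_fpsI:
  fixes f :: "'i \<Rightarrow> 'b::comm_ring_1 fps"
  assumes fin: "\<And>k. finite (B k)" "\<And>k. B k \<subseteq> A"
    and coeff: "\<And>F k. finite F \<Longrightarrow> B k \<subseteq> F \<Longrightarrow> F \<subseteq> A \<Longrightarrow> (\<Sum>i\<in>F. f i $ k) = s $ k"
  shows "(f has_sum s) A"
  unfolding has_sum_def tendsto_fps_iff
proof
  fix k
  show "\<forall>\<^sub>F F in finite_subsets_at_top A. (sum f F) $ k = s $ k"
    unfolding eventually_finite_subsets_at_top
    by (rule exI[of _ "B k"]) (use fin coeff in \<open>auto simp: fps_sum_nth\<close>)
qed

text \<open>Only indices in the box with all four entries at most \<open>k\<close> affect the
  coefficient at \<open>k\<close>. The nesting puts the third index before the second, which is the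
  order in which the sums are evaluated later.\<close>

lemma has_sum_adic_sum4:
  fixes f :: "nat \<Rightarrow> nat \<Rightarrow> nat \<Rightarrow> nat \<Rightarrow> 'b::comm_ring_1 fps"
  assumes "\<And>a b c d. fps_X ^ a dvd f a b c d \<and> fps_X ^ b dvd f a b c d \<and>
    fps_X ^ c dvd f a b c d \<and> fps_X ^ d dvd f a b c d"
  shows "((\<lambda>(a, b, c, d). f a b c d) has_sum
     adic_sum (\<lambda>a. adic_sum (\<lambda>c. adic_sum (\<lambda>b. adic_sum (\<lambda>d. f a b c d))))) UNIV"
    (is "(?f has_sum ?s) UNIV")
proof (rule has_sum_fpsI[where B = "\<lambda>k. {..k} \<times> {..k} \<times> {..k} \<times> {..k}"])
  fix F :: "(nat \<times> nat \<times> nat \<times> nat) set" and k :: nat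
  assume F: "finite F" "{..k} \<times> {..k} \<times> {..k} \<times> {..k} \<subseteq> F"
  have zero: "f a b c d $ k = 0" if "k < a \<or> k < b \<or> k < c \<or> k < d" for a b c d
    using that assms[of a b c d, unfolded fps_X_power_dvd_iff] by blast
  have "(\<Sum>i\<in>F. ?f i $ k) = (\<Sum>i\<in>{..k} \<times> {..k} \<times> {..k} \<times> {..k}. ?f i $ k)"
    by (rule sum.mono_neutral_right) (use F zero in \<open>auto simp flip: not_less\<close>)
  also have "\<dots> = (\<Sum>a\<le>k. \<Sum>b\<le>k. \<Sum>c\<le>k. \<Sum>d\<le>k. f a b c d $ k)"
    by (simp add: sum.cartesian_product split_def)
  also have "\<dots> = (\<Sum>a\<le>k. \<Sum>c\<le>k. \<Sum>b\<le>k. \<Sum>d\<le>k. f a b c d $ k)"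
    by (intro sum.cong refl sum.swap)
  finally show "(\<Sum>i\<in>F. ?f i $ k) = ?s $ k" by (simp add: adic_sum_nth)
qed auto

subsection \<open>Reciprocals of series with constant term 1\<close>

text \<open>Prescribing the leading coefficient 1 of the inverse makes this meaningful over any
  commutative ring; for constant term 1 it is the genuine inverse.\<close>

definition fps_recip :: "'b::comm_ring_1 fps \<Rightarrow> 'b fps" where
  "fps_recip u = fps_right_inverse u 1"

lemma fps_recip_right: "u $ 0 = 1 \<Longrightarrow> u * fps_recip u = 1"
  unfolding fps_recip_def by (rule fps_right_inverse) simp

lemma fps_recip_eqI:
  assumes "u * v = 1" "u $ 0 = 1"
  shows "fps_recip u = v"
proof -
  have "fps_recip u = fps_recip u * (u * v)" using assms by simp
  also have "\<dots> = (u * fps_recip u) * v" by (simp add: mult_ac)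
  finally show ?thesis using assms by (simp add: fps_recip_right)
qed

lemma fps_recip_one [simp]: "fps_recip 1 = 1"
  by (rule fps_recip_eqI) auto

lemma fps_recip_mult:
  assumes "u $ 0 = 1" "v $ 0 = 1"
  shows "fps_recip (u * v) = fps_recip u * fps_recip v"
proof (rule fps_recip_eqI)
  have "u * v * (fps_recip u * fps_recip v) = (u * fps_recip u) * (v * fps_recip v)"
    by (simp add: mult_ac)
  then show "u * v * (fps_recip u * fps_recip v) = 1" using assms by (simp add: fps_recip_right)
qed (use assms in simp)

text \<open>Library division strips the subdegree and then inverts the unit factor. For constant
  term 1 the first step is trivial, and the second only needs \<open>inverse 1 = 1\<close> among the
  coefficients.\<close>

lemma fps_divide_eq_recip:
  fixes u :: "'a::field fps fps fps"
  assumes "u $ 0 = 1"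
  shows "a / u = a * fps_recip u"
proof -
  have "u \<noteq> 0" using assms by auto
  then have "subdegree u = 0" "unit_factor u = u" using assms
    by (auto simp: subdegree_eq_0_iff)
  moreover have "inverse (1 :: 'a fps fps) = 1" by (simp add: fps_inverse_one')
  ultimately have "a / u = a * inverse u" by (simp add: fps_divide_def)
  also have "inverse u = fps_right_inverse u (inverse 1)" by (simp only: fps_inverse_def assms)
  finally show ?thesis
    using \<open>inverse 1 = 1\<close> by (simp only: fps_recip_def)
qed

subsection \<open>q-Pochhammer symbols\<close>

lemma qpoch_0 [simp]: "qpoch A p (enat 0) = 1"
  by (simp add: qpoch_def)

lemma qpoch_Suc: "qpoch A p (enat (Suc n)) = qpoch A p (enat n) * (1 - A * p ^ n)"
  by (simp add: qpoch_def)

lemma qpoch_Suc_shift: "qpoch A p (enat (Suc n)) = (1 - A) * qpoch (A * p) p (enat n)"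
  unfolding qpoch_def by (simp add: prod.lessThan_Suc_shift mult.assoc del: prod.lessThan_Suc)

lemma qpoch_nth_0 [simp]:
  fixes A :: "'b::comm_ring_1 fps"
  shows "A $ 0 = 0 \<Longrightarrow> qpoch A p (enat n) $ 0 = 1"
  by (induction n) (simp_all add: qpoch_Suc)

lemma qpoch_1 [simp]: "qpoch A p 1 = 1 - A"
  by (simp add: qpoch_def one_enat_def)

lemma adic_mult_diff:
  fixes a b c d :: "'b::comm_ring_1 fps"
  assumes "fps_X ^ N dvd a - b" "fps_X ^ N dvd c - d"
  shows "fps_X ^ N dvd a * c - b * d"
proof -
  have "a * c - b * d = (a - b) * c + b * (c - d)" by (simp add: algebra_simps)
  then show ?thesis using assms by simp
qed

text \<open>The next factor differs from 1 by a multiple of \<open>p ^ n\<close>, so the partial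
  products stabilise modulo \<open>fps_X ^ n\<close>. This also proves that the infinite product
  converges.\<close>

lemma qpoch_inf_approx:
  fixes A p :: "'b::idom fps"
  assumes "A $ 0 = 0" "p $ 0 = 0"
  shows "fps_X ^ N dvd qpoch A p \<infinity> - qpoch A p (enat N)"
proof -
  define P where "P n = qpoch A p (enat n)" for n
  \<comment> \<open>The limit is read off diagonally: the coefficient at \<open>k\<close> is final
    once \<open>Suc k\<close> factors are present.\<close>
  define L where "L = Abs_fps (\<lambda>k. P (Suc k) $ k)"
  have step: "fps_X ^ n dvd P (Suc n) - P n" for n
  proof -
    have "P (Suc n) - P n = p ^ n * (- (P n * A))"
      by (simp add: P_def qpoch_Suc algebra_simps)
    then show ?thesis using fps_X_power_dvd_power[OF assms(2), of n] by simp
  qed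
  have stable: "P n $ k = P m $ k" if "k < m" "m \<le> n" for k m n
    using that(2,1)
  proof (induction n rule: dec_induct)
    case (step n)
    then show ?case using \<open>fps_X ^ n dvd P (Suc n) - P n\<close> by (auto simp: fps_X_power_dvd_iff)
  qed simp
  have L: "L $ k = P n $ k" if "k < n" for k n
    using stable[of k "Suc k" n] that by (simp add: L_def)
  have "P \<longlonglongrightarrow> L"
    unfolding tendsto_fps_iff eventually_sequentially by (metis L Suc_le_eq)
  \<comment> \<open>\<open>has_prod\<close> uses partial products over indices up to and including
    \<open>n\<close>, hence the shift; it also asks for a nonzero limit, which the constant term 1
    provides.\<close>
  then have "(\<lambda>n. P (Suc n)) \<longlonglongrightarrow> L" by (rule LIMSEQ_Suc)
  moreover have "L $ 0 = 1" using L[of 0 1] assms by (simp add: P_def)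
  ultimately have "(\<lambda>k. 1 - A * p ^ k) has_prod L"
    by (auto simp: has_prod_def raw_has_prod_def P_def qpoch_def lessThan_Suc_atMost)
  then have "qpoch A p \<infinity> = L" by (simp add: qpoch_def has_prod_unique[symmetric])
  then show ?thesis by (auto simp: fps_X_power_dvd_iff L P_def)
qed

lemma qpoch_inf_nth_0 [simp]:
  fixes A p :: "'b::idom fps"
  assumes "A $ 0 = 0" "p $ 0 = 0"
  shows "qpoch A p \<infinity> $ 0 = 1"
  using qpoch_inf_approx[OF assms, of 1] qpoch_nth_0[OF assms(1), of p 1] unfolding fps_X_power_dvd_iff by simp

lemma qpoch_inf_split:
  fixes A p :: "'b::idom fps"
  assumes "A $ 0 = 0" "p $ 0 = 0"
  shows "qpoch A p \<infinity> = qpoch A p (enat n) * qpoch (A * p ^ n) p \<infinity>"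
proof (induction n)
  case (Suc n)
  have "qpoch B p \<infinity> = (1 - B) * qpoch (B * p) p \<infinity>" if B: "B $ 0 = 0" for B
  proof (rule fps_eqI_adic)
    fix N
    have 1: "fps_X ^ N dvd (1 - B) * (qpoch (B * p) p \<infinity> - qpoch (B * p) p (enat N))"
      using B assms by (intro dvd_mult qpoch_inf_approx) auto
    \<comment> \<open>Taking \<open>Suc N\<close> factors here matches \<open>1 - B\<close> times
      the \<open>N\<close> factors started at \<open>B * p\<close>.\<close>
    have "fps_X ^ Suc N dvd qpoch B p \<infinity> - qpoch B p (enat (Suc N))"
      using B assms by (intro qpoch_inf_approx) auto
    then have 2: "fps_X ^ N dvd qpoch B p \<infinity> - qpoch B p (enat (Suc N))"
      by (rule power_le_dvd) simp
    show "fps_X ^ N dvd qpoch B p \<infinity> - (1 - B) * qpoch (B * p) p \<infinity>"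
      using dvd_diff[OF 2 1] by (simp add: qpoch_Suc_shift algebra_simps)
  qed
  from this[of "A * p ^ n"] Suc show ?case
    using assms by (simp add: qpoch_Suc mult_ac)
qed simp

text \<open>Each factor is a difference of squares; the finite identity passes to the limit modulo
  every \<open>fps_X ^ N\<close>.\<close>

lemma qpoch_inf_square:
  fixes z p :: "'b::idom fps"
  assumes "z $ 0 = 0" "p $ 0 = 0"
  shows "qpoch (z ^ 2) (p ^ 2) \<infinity> = qpoch z p \<infinity> * qpoch (- z) p \<infinity>"
proof (rule fps_eqI_adic)
  fix N
  have fin: "qpoch (z ^ 2) (p ^ 2) (enat n) = qpoch z p (enat n) * qpoch (- z) p (enat n)" for n
  proof (induction n)
    case (Suc n)
    have "1 - z ^ 2 * (p ^ 2) ^ n = (1 - z * p ^ n) * (1 + z * p ^ n)"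
      by (simp add: algebra_simps power2_eq_square power_mult_distrib flip: power_mult)
    then show ?case by (simp add: qpoch_Suc Suc mult_ac)
  qed simp
  have "fps_X ^ N dvd qpoch z p \<infinity> * qpoch (- z) p \<infinity> - qpoch (z ^ 2) (p ^ 2) (enat N)"
    unfolding fin using assms by (intro adic_mult_diff qpoch_inf_approx) auto
  moreover have "fps_X ^ N dvd qpoch (z ^ 2) (p ^ 2) \<infinity> - qpoch (z ^ 2) (p ^ 2) (enat N)"
    using assms by (intro qpoch_inf_approx) (auto simp: power2_eq_square)
  ultimately show "fps_X ^ N dvd qpoch (z ^ 2) (p ^ 2) \<infinity> - qpoch z p \<infinity> * qpoch (- z) p \<infinity>"
    by (metis (no_types, lifting) dvd_diff diff_diff_eq2 diff_add_cancel)
qed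

text \<open>Solves a first-order q-difference equation: iterating \<open>rec\<close> from 0 to
  \<open>N\<close> and letting \<open>H N\<close> tend to 1 leaves the two infinite products
  \<open>U\<close> and \<open>V\<close>. The cross-multiplied form avoids division.\<close>

lemma adic_limit_recurrence:
  fixes H :: "nat \<Rightarrow> 'b::idom fps"
  assumes rec: "\<And>N. u N * H N = v N * H (Suc N)"
    and H: "\<And>N. fps_X ^ N dvd H N - 1"
    and U: "\<And>N. fps_X ^ N dvd U - (\<Prod>i<N. u i)"
    and V: "\<And>N. fps_X ^ N dvd V - (\<Prod>i<N. v i)"
  shows "U * H 0 = V"
proof (rule fps_eqI_adic)
  fix N
  have iter: "(\<Prod>i<N. u i) * H 0 = (\<Prod>i<N. v i) * H N" for N
  proof (induction N)
    case (Suc N)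
    have "(\<Prod>i<Suc N. u i) * H 0 = u N * ((\<Prod>i<N. u i) * H 0)" by (simp add: mult_ac)
    also have "\<dots> = (\<Prod>i<N. v i) * (u N * H N)" unfolding Suc by (simp only: mult_ac)
    also have "\<dots> = (\<Prod>i<Suc N. v i) * H (Suc N)" unfolding rec by (simp add: mult_ac)
    finally show ?case .
  qed simp
  have "fps_X ^ N dvd U * H 0 - (\<Prod>i<N. u i) * H 0"
    by (rule adic_mult_diff) (use U in auto)
  moreover have "fps_X ^ N dvd (\<Prod>i<N. v i) * H N - V * 1"
    using V[of N] by (intro adic_mult_diff H) (metis dvd_minus_iff minus_diff_eq)
  ultimately have "fps_X ^ N dvd
      (U * H 0 - (\<Prod>i<N. u i) * H 0) + ((\<Prod>i<N. v i) * H N - V * 1)"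
    by (rule dvd_add)
  then show "fps_X ^ N dvd U * H 0 - V" by (simp add: iter)
qed

subsection \<open>The q-binomial theorem\<close>

lemma recip_qpoch_Suc:
  fixes A p :: "'b::idom fps"
  assumes "A $ 0 = 0"
  shows "fps_recip (qpoch A p (enat (Suc n))) * (1 - A * p ^ n) = fps_recip (qpoch A p (enat n))"
proof -
  have "(1 - A * p ^ n) $ 0 = 1" using assms by simp
  then show ?thesis
    using fps_recip_right[of "1 - A * p ^ n"] assms
    by (simp add: qpoch_Suc fps_recip_mult mult.assoc mult.commute[of "fps_recip (1 - _)"])
qed

text \<open>The series \<open>B t\<close> satisfies
  \<open>(1 - t) * B t = (1 - a * t) * B (t * p)\<close>, and iterating in \<open>t\<close> produces
  both products.\<close>

lemma q_binomial:
  fixes a t p :: "'b::idom fps"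
  assumes t: "t $ 0 = 0" and p: "p $ 0 = 0"
  shows "qpoch t p \<infinity> * adic_sum (\<lambda>n. qpoch a p (enat n) * fps_recip (qpoch p p (enat n)) * t ^ n)
    = qpoch (a * t) p \<infinity>"
proof -
  define c where "c n = qpoch a p (enat n) * fps_recip (qpoch p p (enat n))" for n
  have c_Suc: "c (Suc n) * (1 - p ^ Suc n) = c n * (1 - a * p ^ n)" for n
  proof -
    have "c (Suc n) * (1 - p ^ Suc n) = qpoch a p (enat n) * (1 - a * p ^ n) *
        (fps_recip (qpoch p p (enat (Suc n))) * (1 - p * p ^ n))"
      unfolding c_def by (subst qpoch_Suc) (simp add: mult_ac)
    then show ?thesis unfolding recip_qpoch_Suc[OF p] by (simp add: c_def mult_ac)
  qed
  define B where "B t = adic_sum (\<lambda>n. c n * t ^ n)" for t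
  have rec: "(1 - t) * B t = (1 - a * t) * B (t * p)" if t: "t $ 0 = 0" for t
  proof -
    have tn: "fps_X ^ n dvd t ^ n" for n by (rule fps_X_power_dvd_power) fact
    have tp: "fps_X ^ n dvd (t * p) ^ n" for n by (rule fps_X_power_dvd_power) (use t in simp)
    \<comment> \<open>\<open>c_Suc\<close> rewrites the part of the \<open>n\<close>-th difference
      containing \<open>t ^ Suc n\<close> as \<open>G (Suc n)\<close>. The factor
      \<open>1 - p ^ n\<close> makes \<open>G 0\<close> vanish.\<close>
    define G where "G n = - (c n * (1 - p ^ n) * t ^ n)" for n
    have "(1 - t) * B t - (1 - a * t) * B (t * p) =
        adic_sum (\<lambda>n. (1 - t) * (c n * t ^ n) - (1 - a * t) * (c n * (t * p) ^ n))"
      unfolding B_def by (simp add: adic_sum_diff adic_sum_cmult tn tp)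
    also have "(1 - t) * (c n * t ^ n) - (1 - a * t) * (c n * (t * p) ^ n) = G (Suc n) - G n" for n
    proof -
      have "G (Suc n) = - (c n * (1 - a * p ^ n) * t ^ Suc n)" unfolding G_def c_Suc ..
      then show ?thesis by (simp add: G_def power_mult_distrib algebra_simps)
    qed
    then have "adic_sum (\<lambda>n. (1 - t) * (c n * t ^ n) - (1 - a * t) * (c n * (t * p) ^ n)) =
        adic_sum (\<lambda>n. G (Suc n) - G n)" by presburger
    also have "\<dots> = - G 0" by (rule adic_sum_telescope) (simp add: G_def tn)
    finally show ?thesis by (simp add: G_def)
  qed
  have "qpoch t p \<infinity> * B (t * p ^ 0) = qpoch (a * t) p \<infinity>"
  proof (rule adic_limit_recurrence)
    fix N
    show "(1 - t * p ^ N) * B (t * p ^ N) = (1 - (a * t) * p ^ N) * B (t * p ^ Suc N)"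
      using rec[of "t * p ^ N"] t by (simp add: mult_ac)
    show "fps_X ^ N dvd qpoch t p \<infinity> - (\<Prod>i<N. 1 - t * p ^ i)"
      using qpoch_inf_approx[OF t p, of N] by (simp add: qpoch_def)
    show "fps_X ^ N dvd qpoch (a * t) p \<infinity> - (\<Prod>i<N. 1 - (a * t) * p ^ i)"
      using qpoch_inf_approx[OF _ p, of "a * t" N] t by (simp add: qpoch_def)
    \<comment> \<open>Terms with \<open>n > 0\<close> carry a factor \<open>p ^ N\<close>, so modulo
      \<open>fps_X ^ N\<close> only the leading term 1 survives.\<close>
    have "fps_X ^ N dvd c n * (t * p ^ N) ^ n" if "n > 0" for n
      using that fps_X_power_dvd_power[OF p, of N]
      by (metis dvd_mult dvd_power dvd_trans)
    then have "fps_X ^ N dvd B (t * p ^ N) - c 0 * (t * p ^ N) ^ 0"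
      unfolding B_def by (rule adic_sum_minus_head)
    then show "fps_X ^ N dvd B (t * p ^ N) - 1"
      by (simp add: c_def)
  qed
  then show ?thesis by (simp add: B_def c_def)
qed

lemma qpoch_zero [simp]: "qpoch 0 p n = (1 :: 'b::idom fps)"
  by (cases n) (simp_all add: qpoch_def has_prod_unique[OF has_prod_one, symmetric])

lemma q_exponential:
  fixes t p :: "'b::idom fps"
  assumes "t $ 0 = 0" "p $ 0 = 0"
  shows "qpoch t p \<infinity> * adic_sum (\<lambda>n. t ^ n * fps_recip (qpoch p p (enat n))) = 1"
  using q_binomial[OF assms, of 0] by (simp add: mult_ac)

text \<open>The weight splits the series into \<open>B t + a * t * B (t * p)\<close>. Both parts are
  multiples of the same infinite product, and the cofactors combine as (1 - a t) + a t (1 - t) = 1 -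
  a t^2.\<close>

lemma q_binomial_pair:
  fixes a t p :: "'b::idom fps"
  assumes t: "t $ 0 = 0" and p: "p $ 0 = 0"
  shows "qpoch t p \<infinity> * adic_sum (\<lambda>n. qpoch a p (enat n) * fps_recip (qpoch p p (enat n)) * t ^ n *
      (1 + a * t * p ^ n)) = qpoch (a * t * p) p \<infinity> * (1 - a * t ^ 2)"
    (is "?L = _")
proof -
  define B where "B t = adic_sum (\<lambda>n. qpoch a p (enat n) * fps_recip (qpoch p p (enat n)) * t ^ n)"
    for t
  have tp: "fps_X ^ n dvd (t * p) ^ n" for n by (rule fps_X_power_dvd_power) (use t in simp)
  have "adic_sum (\<lambda>n. qpoch a p (enat n) * fps_recip (qpoch p p (enat n)) * t ^ n *
      (1 + a * t * p ^ n)) = B t + a * t * B (t * p)"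
    unfolding B_def
    by (subst adic_sum_cmult[symmetric], simp add: tp, subst adic_sum_add[symmetric])
       (simp add: algebra_simps power_mult_distrib)
  moreover have "qpoch t p \<infinity> * B t = (1 - a * t) * qpoch (a * t * p) p \<infinity>"
    unfolding B_def q_binomial[OF t p]
    using qpoch_inf_split[of "a * t" p 1] t p by (simp add: qpoch_Suc)
  moreover have "qpoch t p \<infinity> * B (t * p) = (1 - t) * qpoch (a * t * p) p \<infinity>"
  proof -
    have "qpoch t p \<infinity> = (1 - t) * qpoch (t * p) p \<infinity>"
      using qpoch_inf_split[OF t p, of 1] by (simp add: qpoch_Suc)
    moreover have "qpoch (t * p) p \<infinity> * B (t * p) = qpoch (a * t * p) p \<infinity>"
      unfolding B_def using q_binomial[of "t * p" p a] t p by (simp add: mult_ac)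
    ultimately show ?thesis by (simp add: mult.assoc)
  qed
  ultimately have "?L = (1 - a * t) * qpoch (a * t * p) p \<infinity> + a * t * ((1 - t) * qpoch (a * t * p) p \<infinity>)"
    by (simp only: distrib_left mult.left_commute[of "qpoch t p \<infinity>"])
  then show ?thesis by (simp add: algebra_simps power2_eq_square)
qed

subsection \<open>A quadratic summation\<close>

text \<open>
  With \<open>P = p\<^sup>n\<close>, the factor \<open>1 + z Y P\<^sup>2\<close> is the rational certificate for the q-difference
  equation of the sum below, found by undetermined coefficients in \<open>P\<close>.
\<close>

lemma telescoping_certificate:
  fixes z Y p P :: "'b::comm_ring_1"
  shows "(1 - z^2 * Y * p^2 * P^2) * (1 - z^2 * Y^2 * P^4)
       - (1 + z) * (P * (1 - z * Y * P) * (1 - z^2 * p^2 * Y^2 * P^4))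
     = (1 - P) * (1 - z^2 * Y * p^2 * P^2) * (1 + z * Y * P^2)
       - z * P * (1 - z * Y * P) * (1 - Y * P^2) * (1 + z * Y * p^2 * P^2)"
proof -
  define w r s where "w = z * Y" and "r = p^2" and "s = P^2"
  have e: "z^2 * Y * p^2 * P^2 = z * w * r * s" "z^2 * Y^2 * P^4 = w * w * s * s"
     "z^2 * p^2 * Y^2 * P^4 = w * w * r * s * s" "s = P * P"
    by (simp_all add: w_def r_def s_def power2_eq_square power4_eq_xxxx mult_ac)
  show ?thesis 
    unfolding e(1-3) unfolding w_def[symmetric] r_def[symmetric] s_def[symmetric]
    unfolding e(4)  by (simp add: algebra_simps w_def)
qed

text \<open>As a function of \<open>z\<close> with \<open>Y\<close> fixed, the sum obeys a
  first-order q-difference equation under \<open>z\<close> to \<open>z * p\<close>, proved by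
  creative telescoping with the certificate above, and it tends to 1 along
  \<open>z * p ^ N\<close>.\<close>

lemma quadratic_sum:
  fixes z Y p :: "'b::idom fps"
  assumes z: "z $ 0 = 0" and Y: "Y $ 0 = 0" and p: "p $ 0 = 0"
  shows "qpoch (z^2 * Y * p^2) (p^2) \<infinity> *
     adic_sum (\<lambda>n. z ^ n * p ^ (n choose 2) * qpoch (z * Y) p (enat n) * qpoch Y (p^2) (enat n)
       * fps_recip (qpoch p p (enat n)) * fps_recip (qpoch (z^2 * Y * p^2) (p^2) (enat n))
       * (1 - z^2 * Y^2 * p ^ (4 * n)))
   = qpoch (- z) p \<infinity> * qpoch (z * Y) p \<infinity>"
proof -
  define K where "K z n = z ^ n * p ^ (n choose 2) * qpoch Y (p^2) (enat n)
       * fps_recip (qpoch p p (enat n))" for z n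
  define T where "T z n = K z n * qpoch (z * Y) p (enat n)
       * fps_recip (qpoch (z^2 * Y * p^2) (p^2) (enat n)) * (1 - z^2 * Y^2 * p ^ (4 * n))" for z n
  define S where "S z = adic_sum (T z)" for z
  have p2: "(p ^ 2) $ 0 = 0" using p by (simp add: power2_eq_square)
  have K_dvd: "fps_X ^ n dvd K z n" if "z $ 0 = 0" for z n
    unfolding K_def using fps_X_power_dvd_power[OF that, of n] by (intro dvd_mult2)
  have T_dvd: "fps_X ^ n dvd T z n" if "z $ 0 = 0" for z n
    unfolding T_def using K_dvd[OF that, of n] by (intro dvd_mult2)
  have rec: "(1 - z^2 * Y * p^2) * S z = (1 + z) * (1 - z * Y) * S (z * p)" if z: "z $ 0 = 0" for z
  proof -
    define b where "b = z^2 * Y * p^2"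
    have b: "b $ 0 = 0" using Y by (simp add: b_def)
    \<comment> \<open>The common factor of \<open>(1 - b) * T z n\<close> and
      \<open>(1 - z * Y) * T (z * p) n\<close>; what remains of each is a polynomial in
      \<open>p ^ n\<close>.\<close>
    define C where "C n = K z n * qpoch (z * Y) p (enat n)
       * fps_recip (qpoch (b * p^2) (p^2) (enat n))" for n
    \<comment> \<open>The factors \<open>1 - p ^ n\<close> and \<open>1 - b * (p^2) ^ n\<close>
      cancel the last factors of the denominators in \<open>C n\<close>, so that
      \<open>G (Suc n)\<close> is again a polynomial multiple of \<open>C n\<close>. The last factor
      is the certificate, and \<open>G 0 = 0\<close>.\<close>
    define G where "G n = - (C n * (1 - p ^ n) * (1 - b * (p^2) ^ n) * (1 + z * Y * (p^2) ^ n))" for n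
    have p4: "p ^ (4 * n) = (p ^ n) ^ 4" "(p^2) ^ n = (p ^ n)^2" for n
      by (simp_all add: mult.commute flip: power_mult)
    have 1: "(1 - b) * T z n = C n * ((1 - b * (p ^ n)^2) * (1 - z^2 * Y^2 * (p ^ n) ^ 4))" for n
    proof -
      have "(1 - b) * fps_recip (qpoch b (p^2) (enat n)) =
          (1 - b) * (fps_recip (qpoch b (p^2) (enat (Suc n))) * (1 - b * (p^2) ^ n))"
        by (simp only: recip_qpoch_Suc[OF b])
      also have "fps_recip (qpoch b (p^2) (enat (Suc n))) =
          fps_recip (1 - b) * fps_recip (qpoch (b * p^2) (p^2) (enat n))"
        unfolding qpoch_Suc_shift by (rule fps_recip_mult) (use b in simp_all)
      finally have "(1 - b) * fps_recip (qpoch b (p^2) (enat n)) =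
          ((1 - b) * fps_recip (1 - b)) * (fps_recip (qpoch (b * p^2) (p^2) (enat n)) * (1 - b * (p^2) ^ n))"
        by (simp only: mult_ac)
      also have "(1 - b) * fps_recip (1 - b) = 1" by (rule fps_recip_right) (use b in simp)
      finally have *: "(1 - b) * fps_recip (qpoch b (p^2) (enat n)) =
          fps_recip (qpoch (b * p^2) (p^2) (enat n)) * (1 - b * (p ^ n)^2)" by (simp add: p4)
      have "(1 - b) * T z n = K z n * qpoch (z * Y) p (enat n)
          * ((1 - b) * fps_recip (qpoch b (p^2) (enat n))) * (1 - z^2 * Y^2 * (p ^ n) ^ 4)"
        unfolding T_def b_def[symmetric] p4 by (simp only: mult_ac)
      then show ?thesis unfolding * C_def by (simp only: mult_ac)
    qed
    have 2: "(1 - z * Y) * T (z * p) n =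
        C n * (p ^ n * (1 - z * Y * p ^ n) * (1 - z^2 * p^2 * Y^2 * (p ^ n) ^ 4))" for n
    proof -
      have K: "K (z * p) n = K z n * p ^ n" by (simp add: K_def power_mult_distrib mult_ac)
      have b': "(z * p)^2 * Y * p^2 = b * p^2" "z * p * Y = z * Y * p"
        by (simp_all add: b_def power_mult_distrib mult_ac)
      have *: "(1 - z * Y) * qpoch (z * Y * p) p (enat n) = qpoch (z * Y) p (enat n) * (1 - z * Y * p ^ n)"
        using qpoch_Suc[of "z * Y" p n] qpoch_Suc_shift[of "z * Y" p n] by simp
      have "(1 - z * Y) * T (z * p) n = K z n * p ^ n * ((1 - z * Y) * qpoch (z * Y * p) p (enat n))
          * fps_recip (qpoch (b * p^2) (p^2) (enat n)) * (1 - z^2 * p^2 * Y^2 * (p ^ n) ^ 4)"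
        unfolding T_def K p4 b' unfolding power_mult_distrib[of z p 2] by (simp only: mult_ac)
      then show ?thesis unfolding * C_def by (simp only: mult_ac)
    qed
    have 3: "C (Suc n) * (1 - p ^ Suc n) * (1 - b * (p^2) ^ Suc n) =
        C n * (z * p ^ n * (1 - z * Y * p ^ n) * (1 - Y * (p ^ n)^2))" for n
    proof -
      have c: "(Suc n choose 2) = (n choose 2) + n"
        by (simp add: numeral_2_eq_2)
      have "C (Suc n) * (1 - p ^ Suc n) * (1 - b * (p^2) ^ Suc n) =
         z ^ n * z * (p ^ (n choose 2) * p ^ n) * (qpoch Y (p^2) (enat n) * (1 - Y * (p^2) ^ n))
         * (fps_recip (qpoch p p (enat (Suc n))) * (1 - p * p ^ n))
         * (qpoch (z * Y) p (enat n) * (1 - z * Y * p ^ n))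
         * (fps_recip (qpoch (b * p^2) (p^2) (enat (Suc n))) * (1 - b * p^2 * (p^2) ^ n))"
        unfolding C_def K_def c power_add qpoch_Suc[of Y] qpoch_Suc[of "z * Y"] power_Suc
        by (simp only: mult_ac)
      also have "\<dots> = C n * (z * p ^ n * (1 - z * Y * p ^ n) * (1 - Y * (p ^ n)^2))"
        using recip_qpoch_Suc[OF p, of p n] recip_qpoch_Suc[of "b * p^2" "p^2" n] b
        unfolding C_def K_def p4(2)[symmetric] by (simp add: mult_ac)
      finally show ?thesis .
    qed
    have step: "(1 - b) * T z n - (1 + z) * ((1 - z * Y) * T (z * p) n) = G (Suc n) - G n" for n
    proof -
      define U where "U = (1 - p ^ n) * (1 - b * (p ^ n)^2) * (1 + z * Y * (p ^ n)^2)"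
      define V where "V = z * p ^ n * (1 - z * Y * p ^ n) * (1 - Y * (p ^ n)^2)
          * (1 + z * Y * p^2 * (p ^ n)^2)"
      have "G (Suc n) = - (C n * V)"
        unfolding G_def 3 by (simp add: V_def p4 mult_ac power_mult_distrib)
      moreover have "G n = - (C n * U)"
        by (simp add: G_def U_def p4 mult_ac)
      moreover have "(1 - b) * T z n - (1 + z) * ((1 - z * Y) * T (z * p) n) =
         C n * ((1 - b * (p ^ n)^2) * (1 - z^2 * Y^2 * (p ^ n) ^ 4)
       - (1 + z) * (p ^ n * (1 - z * Y * p ^ n) * (1 - z^2 * p^2 * Y^2 * (p ^ n) ^ 4)))"
        unfolding 1 2 by (simp only: right_diff_distrib mult_ac)
      then have "(1 - b) * T z n - (1 + z) * ((1 - z * Y) * T (z * p) n) = C n * (U - V)"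
        unfolding b_def U_def V_def telescoping_certificate .
      ultimately show ?thesis by (simp add: right_diff_distrib)
    qed
    have zp: "(z * p) $ 0 = 0" using z by simp
    have "(1 - b) * S z - (1 + z) * ((1 - z * Y) * S (z * p)) =
        adic_sum (\<lambda>n. (1 - b) * T z n - (1 + z) * ((1 - z * Y) * T (z * p) n))"
      unfolding S_def by (simp add: adic_sum_diff adic_sum_cmult T_dvd z zp)
    also have "\<dots> = - G 0"
      unfolding step by (rule adic_sum_telescope)
        (use K_dvd[OF z] in \<open>simp add: G_def C_def dvd_mult2\<close>)
    finally show ?thesis by (simp add: G_def b_def mult.assoc)
  qed
  have "qpoch (z^2 * Y * p^2) (p^2) \<infinity> * S (z * p ^ 0) = qpoch (- z) p \<infinity> * qpoch (z * Y) p \<infinity>"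
  proof (rule adic_limit_recurrence)
    fix N
    \<comment> \<open>Passing to \<open>z * p ^ N\<close> multiplies \<open>z^2\<close> by
      \<open>(p^2) ^ N\<close>, which gives base \<open>p^2\<close> on the left and base
      \<open>p\<close> on the right.\<close>
    show "(1 - z^2 * Y * p^2 * (p^2) ^ N) * S (z * p ^ N) =
       ((1 - (- z) * p ^ N) * (1 - z * Y * p ^ N)) * S (z * p ^ Suc N)"
      using rec[of "z * p ^ N"] z
      by (simp add: mult_ac power_mult_distrib) (simp add: mult_ac flip: power_mult)
    show "fps_X ^ N dvd qpoch (z^2 * Y * p^2) (p^2) \<infinity> - (\<Prod>i<N. 1 - z^2 * Y * p^2 * (p^2) ^ i)"
      using qpoch_inf_approx[of "z^2 * Y * p^2" "p^2" N] p2 by (simp add: qpoch_def)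
    show "fps_X ^ N dvd qpoch (- z) p \<infinity> * qpoch (z * Y) p \<infinity> -
        (\<Prod>i<N. (1 - (- z) * p ^ i) * (1 - z * Y * p ^ i))"
      using adic_mult_diff[OF qpoch_inf_approx[of "-z" p N] qpoch_inf_approx[of "z * Y" p N]] z p
      by (simp add: qpoch_def prod.distrib)
    have N: "fps_X ^ N dvd z * p ^ N"
      using fps_X_power_dvd_power[OF p, of N] by (rule dvd_mult)
    have "fps_X ^ N dvd T (z * p ^ N) n" if "n > 0" for n
      unfolding T_def K_def using that N
      by (intro dvd_mult2) (metis dvd_power dvd_trans)
    then have "fps_X ^ N dvd S (z * p ^ N) - T (z * p ^ N) 0"
      unfolding S_def by (rule adic_sum_minus_head)
    \<comment> \<open>The head term is not 1 itself, but its correction contains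
      \<open>z * p ^ N\<close> and also vanishes modulo \<open>fps_X ^ N\<close>.\<close>
    then have "fps_X ^ N dvd S (z * p ^ N) - (1 - (z * p ^ N)^2 * Y^2)"
      by (simp add: T_def K_def binomial_eq_0)
    moreover have "fps_X ^ N dvd (z * p ^ N)^2 * Y^2"
      unfolding power2_eq_square[of "z * p ^ N"] by (rule dvd_mult2[OF dvd_mult2[OF N]])
    ultimately have "fps_X ^ N dvd
        S (z * p ^ N) - (1 - (z * p ^ N)^2 * Y^2) - (z * p ^ N)^2 * Y^2"
      by (rule dvd_diff)
    then show "fps_X ^ N dvd S (z * p ^ N) - 1"
      by (simp only: diff_diff_eq diff_add_cancel)
  qed
  moreover have "T z = (\<lambda>n. z ^ n * p ^ (n choose 2) * qpoch (z * Y) p (enat n) * qpoch Y (p^2) (enat n)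
       * fps_recip (qpoch p p (enat n)) * fps_recip (qpoch (z^2 * Y * p^2) (p^2) (enat n))
       * (1 - z^2 * Y^2 * p ^ (4 * n)))"
    by (simp add: T_def K_def fun_eq_iff mult_ac)
  ultimately show ?thesis by (simp add: S_def)
qed

subsection \<open>The quadruple sum\<close>

lemma quadruple_sum:
  fixes z Y p :: "'b::idom fps"
  assumes z: "z $ 0 = 0" and Y: "Y $ 0 = 0" and p: "p $ 0 = 0"
  shows "qpoch z p \<infinity> * qpoch Y (p^2) \<infinity> *
    adic_sum (\<lambda>n1. adic_sum (\<lambda>n3. adic_sum (\<lambda>n2. adic_sum (\<lambda>n4.
       (z ^ n1 * p ^ (n1 choose 2) * fps_recip (qpoch p p (enat n1)))
     * ((z * Y * p ^ n1) ^ n2 * fps_recip (qpoch p p (enat n2)))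
     * (fps_recip (qpoch (p^2) (p^2) (enat n3)) * (Y * (p^2) ^ n1) ^ n3
        * (1 + z^2 * (Y * (p^2) ^ n1) * (p^2) ^ n3))
     * ((z^2 * (p^2) ^ n3) ^ n4 * fps_recip (qpoch (p^2) (p^2) (enat n4)))))))
   = 1" (is "_ * ?F = 1")
proof -
  define q where "q = p^2"
  have q: "q $ 0 = 0" using p by (simp add: q_def power2_eq_square)
  have zz: "(z^2) $ 0 = 0" using z by (simp add: power2_eq_square)
  define A where "A n = z ^ n * p ^ (n choose 2) * fps_recip (qpoch p p (enat n))" for n
  define B where "B n m = (z * Y * p ^ n) ^ m * fps_recip (qpoch p p (enat m))" for n m
  define C where "C n m = fps_recip (qpoch q q (enat m)) * (Y * q ^ n) ^ m * (1 + z^2 * (Y * q ^ n) * q ^ m)"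
    for n m
  define D where "D n m = (z^2 * q ^ n) ^ m * fps_recip (qpoch q q (enat m))" for n m
  have A_dvd: "fps_X ^ n dvd A n" for n
    unfolding A_def using fps_X_power_dvd_power[OF z] by (intro dvd_mult2)
  have B_dvd: "fps_X ^ m dvd B n m" for n m
    unfolding B_def using z Y by (intro dvd_mult2 fps_X_power_dvd_power) simp
  have C_dvd: "fps_X ^ m dvd C n m" for n m
    unfolding C_def using Y by (intro dvd_mult2 dvd_mult fps_X_power_dvd_power) simp
  have D_dvd: "fps_X ^ m dvd D n m" for n m
    unfolding D_def using zz by (intro dvd_mult2 fps_X_power_dvd_power) simp
  \<comment> \<open>Euler's sum gives the reciprocal of the product started at
    \<open>z * Y * p ^ n\<close>; against the full product only the first \<open>n\<close> factors
    remain. \<open>D_sum\<close> works alike.\<close>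
  have B_sum: "qpoch (z * Y) p \<infinity> * adic_sum (B n) = qpoch (z * Y) p (enat n)" for n
    using q_exponential[of "z * Y * p ^ n" p] qpoch_inf_split[of "z * Y" p n] z Y p
    by (simp add: B_def[abs_def] mult.assoc)
  have D_sum: "qpoch (z^2) q \<infinity> * adic_sum (D n) = qpoch (z^2) q (enat n)" for n
    using q_exponential[of "z^2 * q ^ n" q] qpoch_inf_split[of "z^2" q n] zz q
    by (simp add: D_def[abs_def] mult.assoc)
  define R where "R n = fps_recip (qpoch (z^2 * Y * q) q (enat n))" for n
  \<comment> \<open>This is \<open>q_binomial_pair\<close> in base \<open>q\<close> with
    \<open>a = z^2\<close> and \<open>t = Y * q ^ n\<close>; the finite symbol
    \<open>qpoch (z^2) q (enat m)\<close> is what the sum over \<open>n4\<close> leaves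
    behind.\<close>
  have C_sum: "qpoch Y q \<infinity> * adic_sum (\<lambda>m. C n m * qpoch (z^2) q (enat m)) =
      qpoch (z^2 * Y * q) q \<infinity> * (qpoch Y q (enat n) * R n * (1 - z^2 * Y^2 * p ^ (4 * n)))" for n
  proof -
    have "qpoch Y q \<infinity> * adic_sum (\<lambda>m. C n m * qpoch (z^2) q (enat m)) =
        qpoch Y q (enat n) * (qpoch (Y * q ^ n) q \<infinity> * adic_sum (\<lambda>m. qpoch (z^2) q (enat m) *
          fps_recip (qpoch q q (enat m)) * (Y * q ^ n) ^ m * (1 + z^2 * (Y * q ^ n) * q ^ m)))"
      unfolding qpoch_inf_split[OF Y q, of n] C_def by (simp only: mult_ac)
    also have "\<dots> = qpoch Y q (enat n) * (qpoch (z^2 * (Y * q ^ n) * q) q \<infinity> * (1 - z^2 * (Y * q ^ n)^2))"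
      using Y q by (subst q_binomial_pair) simp_all
    also have "qpoch (z^2 * (Y * q ^ n) * q) q \<infinity> = qpoch (z^2 * Y * q) q \<infinity> * R n"
    proof -
      have "qpoch (z^2 * Y * q) q \<infinity> * R n = (qpoch (z^2 * Y * q) q (enat n) * R n) *
          qpoch (z^2 * Y * q * q ^ n) q \<infinity>"
        using qpoch_inf_split[of "z^2 * Y * q" q n] Y q by (simp add: mult_ac)
      also have "qpoch (z^2 * Y * q) q (enat n) * R n = 1"
        unfolding R_def using Y q by (intro fps_recip_right) simp
      finally show ?thesis by (simp add: mult_ac)
    qed
    also have "z^2 * (Y * q ^ n)^2 = z^2 * Y^2 * p ^ (4 * n)"
      by (simp add: q_def power_mult_distrib mult_ac flip: power_mult)
    finally show ?thesis by (simp only: mult_ac)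
  qed
  \<comment> \<open>\<open>B\<close> depends only on \<open>n1\<close>, \<open>n2\<close> and
    \<open>D\<close> only on \<open>n3\<close>, \<open>n4\<close>, so these two sums are taken
    independently.\<close>
  have inner: "adic_sum (\<lambda>m3. adic_sum (\<lambda>m2. adic_sum (\<lambda>m4. A n * B n m2 * C n m3 * D m3 m4))) =
      A n * adic_sum (B n) * adic_sum (\<lambda>m3. C n m3 * adic_sum (D m3))" for n
  proof -
    have "adic_sum (\<lambda>m2. adic_sum (\<lambda>m4. A n * B n m2 * C n m3 * D m3 m4)) =
        adic_sum (\<lambda>m2. (A n * (C n m3 * adic_sum (D m3))) * B n m2)" for m3
      by (subst adic_sum_cmult[OF D_dvd]) (simp only: mult_ac)
    also have "\<dots> m3 = (A n * adic_sum (B n)) * (C n m3 * adic_sum (D m3))" for m3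
      by (subst adic_sum_cmult[OF B_dvd]) (simp only: mult_ac)
    finally show ?thesis
      using adic_sum_cmult[of "\<lambda>m3. C n m3 * adic_sum (D m3)"] C_dvd by (simp add: dvd_mult2)
  qed
  have C_dvd': "fps_X ^ m dvd C n m * adic_sum (D m)" for n m using C_dvd by (rule dvd_mult2)
  \<comment> \<open>The three products that clear the denominators of the sums over
    \<open>n3\<close>, \<open>n2\<close> and \<open>n4\<close>.\<close>
  let ?c = "qpoch Y q \<infinity> * qpoch (z * Y) p \<infinity> * qpoch (z^2) q \<infinity>"
  have F: "?F = adic_sum (\<lambda>n. A n * adic_sum (B n) * adic_sum (\<lambda>m3. C n m3 * adic_sum (D m3)))"
    unfolding inner[symmetric] unfolding A_def B_def C_def D_def q_def ..
  have "?c * ?F = adic_sum (\<lambda>n. ?c * (A n * adic_sum (B n) * adic_sum (\<lambda>m3. C n m3 * adic_sum (D m3))))"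
    unfolding F using A_dvd by (intro adic_sum_cmult[symmetric] dvd_mult2)
  also have "?c * (A n * adic_sum (B n) * adic_sum (\<lambda>m3. C n m3 * adic_sum (D m3))) =
      qpoch (z^2 * Y * q) q \<infinity> * (A n * qpoch (z * Y) p (enat n) * qpoch Y q (enat n) * R n
        * (1 - z^2 * Y^2 * p ^ (4 * n)))" for n
  proof -
    have "qpoch (z^2) q \<infinity> * adic_sum (\<lambda>m3. C n m3 * adic_sum (D m3)) =
        adic_sum (\<lambda>m3. C n m3 * (qpoch (z^2) q \<infinity> * adic_sum (D m3)))"
      by (subst adic_sum_cmult[OF C_dvd', symmetric]) (simp only: mult_ac)
    then have *: "qpoch (z^2) q \<infinity> * adic_sum (\<lambda>m3. C n m3 * adic_sum (D m3)) =
        adic_sum (\<lambda>m3. C n m3 * qpoch (z^2) q (enat m3))" unfolding D_sum .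
    have "?c * (A n * adic_sum (B n) * adic_sum (\<lambda>m3. C n m3 * adic_sum (D m3))) =
        A n * (qpoch (z * Y) p \<infinity> * adic_sum (B n)) *
        (qpoch Y q \<infinity> * (qpoch (z^2) q \<infinity> * adic_sum (\<lambda>m3. C n m3 * adic_sum (D m3))))"
      by (simp only: mult_ac)
    also have "\<dots> = A n * qpoch (z * Y) p (enat n) * (qpoch (z^2 * Y * q) q \<infinity> *
        (qpoch Y q (enat n) * R n * (1 - z^2 * Y^2 * p ^ (4 * n))))"
      unfolding * B_sum C_sum ..
    finally show ?thesis by (simp only: mult_ac)
  qed
  then have "adic_sum (\<lambda>n. ?c * (A n * adic_sum (B n) * adic_sum (\<lambda>m3. C n m3 * adic_sum (D m3)))) =
      adic_sum (\<lambda>n. qpoch (z^2 * Y * q) q \<infinity> * (A n * qpoch (z * Y) p (enat n) * qpoch Y q (enat n) * R n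
        * (1 - z^2 * Y^2 * p ^ (4 * n))))" by presburger
  also have "\<dots> = qpoch (z^2 * Y * q) q \<infinity> * adic_sum (\<lambda>n. A n * qpoch (z * Y) p (enat n) * qpoch Y q (enat n)
        * R n * (1 - z^2 * Y^2 * p ^ (4 * n)))"
    using A_dvd by (intro adic_sum_cmult dvd_mult2)
  also have "\<dots> = qpoch (- z) p \<infinity> * qpoch (z * Y) p \<infinity>"
    using quadratic_sum[OF z Y p] by (simp add: A_def R_def q_def mult_ac)
  finally have "?c * ?F = qpoch (- z) p \<infinity> * qpoch (z * Y) p \<infinity>" .
  \<comment> \<open>This splits off the desired \<open>qpoch z p \<infinity>\<close>; the rest of
    the prefactor matches the right-hand side and cancels, since its constant term is 1.\<close>
  moreover have "qpoch (z^2) q \<infinity> = qpoch z p \<infinity> * qpoch (- z) p \<infinity>"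
    unfolding q_def by (rule qpoch_inf_square) fact+
  ultimately have "(qpoch (- z) p \<infinity> * qpoch (z * Y) p \<infinity>) * (qpoch z p \<infinity> * qpoch Y q \<infinity> * ?F) =
      (qpoch (- z) p \<infinity> * qpoch (z * Y) p \<infinity>) * 1" by (simp only: mult_ac mult_1 mult_1_right)
  moreover have "(qpoch (- z) p \<infinity> * qpoch (z * Y) p \<infinity>) $ 0 = 1" using z Y p by simp
  then have "qpoch (- z) p \<infinity> * qpoch (z * Y) p \<infinity> \<noteq> 0" by force
  ultimately show ?thesis unfolding q_def using mult_left_cancel by blast
qed

section \<open>Change of variables back to \<open>x\<close>, \<open>y\<close>,
  \<open>q\<close>\<close>

theorem theorem3p1:
  shows "((\<lambda>(n1::nat, n2::nat, n3::nat, n4::nat).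
            (vx ^ (n1 + n2 + 2 * n4) * vy ^ (n2 + n3) * vq ^ (n1 + 3 * n2 + 2 * n3 + 2 * n4)
               * (1 + vx ^ 2 * vy * vq ^ (4 + 4 * (n1 + n3))))
            / (qpoch (vq ^ 2) (vq ^ 2) (enat n1) * qpoch (vq ^ 2) (vq ^ 2) (enat n2)
               * qpoch (vq ^ 4) (vq ^ 4) (enat n3) * qpoch (vq ^ 4) (vq ^ 4) (enat n4))
            * vq ^ (2 * (n1 choose 2) + 2 * n1 * n2 + 4 * n1 * n3 + 4 * n3 * n4))
          has_sum
            (1 / (qpoch (vx * vq) (vq ^ 2) \<infinity> * qpoch (vy * vq ^ 2) (vq ^ 4) \<infinity>)
              :: 'a::field fps fps fps))
          UNIV"
proof -
  define x y q :: "'a fps fps fps" where "x = vx" and "y = vy" and "q = vq"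
  have q: "(q ^ Suc n) $ 0 = 0" for n by (simp add: q_def vq_def)
  define z Y p where "z = x * q" and "Y = y * q^2" and "p = q^2"
  have z: "z $ 0 = 0" and Y: "Y $ 0 = 0" and p: "p $ 0 = 0"
    using q[of 0] q[of 1] by (simp_all add: z_def Y_def p_def eval_nat_numeral)
  have p2: "q^4 = p^2" "(p^2) $ 0 = 0" using p by (simp_all add: p_def power2_eq_square eval_nat_numeral)
  let ?f = "\<lambda>n1 n2 n3 n4. 
       (z ^ n1 * p ^ (n1 choose 2) * fps_recip (qpoch p p (enat n1)))
     * ((z * Y * p ^ n1) ^ n2 * fps_recip (qpoch p p (enat n2)))
     * (fps_recip (qpoch (p^2) (p^2) (enat n3)) * (Y * (p^2) ^ n1) ^ n3
        * (1 + z^2 * (Y * (p^2) ^ n1) * (p^2) ^ n3))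
     * ((z^2 * (p^2) ^ n3) ^ n4 * fps_recip (qpoch (p^2) (p^2) (enat n4)))"
  have "fps_X ^ n1 dvd ?f n1 n2 n3 n4 \<and> fps_X ^ n2 dvd ?f n1 n2 n3 n4 \<and>
      fps_X ^ n3 dvd ?f n1 n2 n3 n4 \<and> fps_X ^ n4 dvd ?f n1 n2 n3 n4" for n1 n2 n3 n4
  proof -
    \<comment> \<open>Each index occurs as the exponent of a series without constant term, which
      yields the four divisibilities.\<close>
    have "fps_X ^ n1 dvd z ^ n1" "fps_X ^ n2 dvd (z * Y * p ^ n1) ^ n2"
      "fps_X ^ n3 dvd (Y * (p^2) ^ n1) ^ n3" "fps_X ^ n4 dvd (z^2 * (p^2) ^ n3) ^ n4"
      using z Y by (auto intro!: fps_X_power_dvd_power simp: power2_eq_square)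
    then show ?thesis by (intro conjI) (simp_all only: dvd_mult dvd_mult2)
  qed
  from has_sum_adic_sum4[of ?f, OF this]
  have "((\<lambda>(n1, n2, n3, n4). ?f n1 n2 n3 n4) has_sum
      fps_recip (qpoch z p \<infinity> * qpoch Y (p^2) \<infinity>)) UNIV"
    by (subst fps_recip_eqI[OF quadruple_sum[OF z Y p]]) (use z Y p p2 in simp_all)
  also have "fps_recip (qpoch z p \<infinity> * qpoch Y (p^2) \<infinity>) = 1 / (qpoch (x * q) (q^2) \<infinity> * qpoch (y * q^2) (q^4) \<infinity>)"
    unfolding p2(1) z_def[symmetric] Y_def[symmetric] unfolding p_def[symmetric]
    by (subst fps_divide_eq_recip) (use z Y p p2 in simp_all)
  also have "(\<lambda>(n1, n2, n3, n4). ?f n1 n2 n3 n4) = (\<lambda>(n1, n2, n3, n4).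
      (x ^ (n1 + n2 + 2 * n4) * y ^ (n2 + n3) * q ^ (n1 + 3 * n2 + 2 * n3 + 2 * n4)
         * (1 + x ^ 2 * y * q ^ (4 + 4 * (n1 + n3))))
      / (qpoch (q ^ 2) (q ^ 2) (enat n1) * qpoch (q ^ 2) (q ^ 2) (enat n2)
         * qpoch (q ^ 4) (q ^ 4) (enat n3) * qpoch (q ^ 4) (q ^ 4) (enat n4))
      * q ^ (2 * (n1 choose 2) + 2 * n1 * n2 + 4 * n1 * n3 + 4 * n3 * n4))"
  proof (intro ext, clarify)
    fix n1 n2 n3 n4 :: nat
    let ?D = "qpoch p p (enat n1) * qpoch p p (enat n2)
         * qpoch (p^2) (p^2) (enat n3) * qpoch (p^2) (p^2) (enat n4)"
    \<comment> \<open>In powers of \<open>q\<close>, \<open>z\<close> counts 1 while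
      \<open>Y\<close> and \<open>p\<close> count 2, so \<open>z * Y\<close> gives the
      \<open>3 * n2\<close>. The cross terms come from \<open>p ^ n1\<close>,
      \<open>(p^2) ^ n1\<close> and \<open>(p^2) ^ n3\<close>.\<close>
    have mono: "z ^ n1 * p ^ (n1 choose 2) * (z * Y * p ^ n1) ^ n2 * (Y * (p^2) ^ n1) ^ n3 * (z^2 * (p^2) ^ n3) ^ n4
       = x ^ (n1 + n2 + 2 * n4) * y ^ (n2 + n3) * q ^ (n1 + 3 * n2 + 2 * n3 + 2 * n4)
         * q ^ (2 * (n1 choose 2) + 2 * n1 * n2 + 4 * n1 * n3 + 4 * n3 * n4)"
    proof -
      have "z ^ n1 = x ^ n1 * q ^ n1" by (simp add: z_def power_mult_distrib)
      moreover have "p ^ (n1 choose 2) = q ^ (2 * (n1 choose 2))" by (simp add: p_def power_mult)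
      moreover have "(z * Y * p ^ n1) ^ n2 = x ^ n2 * y ^ n2 * q ^ (3 * n2 + 2 * n1 * n2)"
        by (simp add: z_def Y_def p_def algebra_simps power_mult_distrib power_add eval_nat_numeral flip: power_mult)
      moreover have "(Y * (p^2) ^ n1) ^ n3 = y ^ n3 * q ^ (2 * n3 + 4 * n1 * n3)"
        by (simp add: Y_def p_def algebra_simps power_mult_distrib power_add flip: power_mult)
      moreover have "(z^2 * (p^2) ^ n3) ^ n4 = x ^ (2 * n4) * q ^ (2 * n4 + 4 * n3 * n4)"
        by (simp add: z_def p_def algebra_simps power_mult_distrib power_add flip: power_mult)
      ultimately show ?thesis by (simp only: power_add mult_ac)
    qed
    have fac: "z^2 * (Y * (p^2) ^ n1) * (p^2) ^ n3 = x ^ 2 * y * q ^ (4 + 4 * (n1 + n3))"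
      by (simp add: z_def Y_def p_def algebra_simps power_mult_distrib power_add eval_nat_numeral flip: power_mult)
    have "fps_recip ?D = fps_recip (qpoch p p (enat n1)) * fps_recip (qpoch p p (enat n2))
         * fps_recip (qpoch (p^2) (p^2) (enat n3)) * fps_recip (qpoch (p^2) (p^2) (enat n4))"
      using p p2 by (simp add: fps_recip_mult)
    then have "?f n1 n2 n3 n4 =
       (z ^ n1 * p ^ (n1 choose 2) * (z * Y * p ^ n1) ^ n2 * (Y * (p^2) ^ n1) ^ n3 * (z^2 * (p^2) ^ n3) ^ n4)
       * (1 + z^2 * (Y * (p^2) ^ n1) * (p^2) ^ n3) * fps_recip ?D"
      by (simp only: mult_ac)
    also have "\<dots> = (x ^ (n1 + n2 + 2 * n4) * y ^ (n2 + n3) * q ^ (n1 + 3 * n2 + 2 * n3 + 2 * n4)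
         * (1 + x ^ 2 * y * q ^ (4 + 4 * (n1 + n3)))) * fps_recip ?D
      * q ^ (2 * (n1 choose 2) + 2 * n1 * n2 + 4 * n1 * n3 + 4 * n3 * n4)"
      unfolding mono fac by (simp only: mult_ac)
    also have "\<dots> = (x ^ (n1 + n2 + 2 * n4) * y ^ (n2 + n3) * q ^ (n1 + 3 * n2 + 2 * n3 + 2 * n4)
         * (1 + x ^ 2 * y * q ^ (4 + 4 * (n1 + n3)))) / ?D
      * q ^ (2 * (n1 choose 2) + 2 * n1 * n2 + 4 * n1 * n3 + 4 * n3 * n4)"
      by (subst fps_divide_eq_recip) (use p p2 in simp_all)
    finally show "?f n1 n2 n3 n4 =
       (x ^ (n1 + n2 + 2 * n4) * y ^ (n2 + n3) * q ^ (n1 + 3 * n2 + 2 * n3 + 2 * n4)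
         * (1 + x ^ 2 * y * q ^ (4 + 4 * (n1 + n3))))
      / (qpoch (q ^ 2) (q ^ 2) (enat n1) * qpoch (q ^ 2) (q ^ 2) (enat n2)
         * qpoch (q ^ 4) (q ^ 4) (enat n3) * qpoch (q ^ 4) (q ^ 4) (enat n4))
      * q ^ (2 * (n1 choose 2) + 2 * n1 * n2 + 4 * n1 * n3 + 4 * n3 * n4)"
      unfolding p2(1) p_def[symmetric] .
  qed
  finally show ?thesis unfolding x_def y_def q_def .
qed

end
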